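(* Assume that for every $\epsilon>0$ there is a constant $C_\epsilon>0$ such that for all integers $R\ge 1$, \[ \sup_{x\in[0,1]}\left|\sum_{n=1}^R \mu(n)e^{2\pi i n x}\right| \le C_\epsilon R^{1/2+\epsilon}. \] Then $\operatorname{FR}(\mu_R)\ge R^{-o(1)}$ as $R\to\infty$; that is, for every $\delta>0$ there exists $R_0(\delta)$ such that $\operatorname{FR}(\mu_R)\ge R^{-\delta}$ for all integers $R\ge R_0(\delta)$.
   Context: $\mu$ denotes the classical Möbius function: $\mu(1)=1$, $\mu(n)=0$ if $n$ is not squarefree, and $\mu(n)=(-1)^k$ if $n$ is squarefree with $k$ prime factors. For an integer $R\ge 1$ let $X_R=\{1,2,\dots,R\}$ and $X_R'=\{n\le R:\mu(n)\ne 0\}$ (the squarefree integers in $X_R$). Let $\mu_R:X_R'\to\{-1,1\}$ be the restriction of $\mu$ to $X_R'$, extended to $X_R$ by $\mu_R(n)=0$ for $n\notin X_R'$. Its Fourier transform is $\widehat{\mu_R}(x)=\sum_{n=1}^R \mu_R(n)e^{-2\pi i n x}$ for $x\in[0,1]$, and its Fourier Ratio is \[ \operatorname{FR}(\mu_R)=\frac{\|\widehat{\mu_R}\|_{L^1([0,1])}}{\|\widehat{\mu_R}\|_{L^2([0,1])}}, \] with norms taken with respect to Lebesgue measure on $[0,1]$. *)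

theory Defs
  imports "HOL-Analysis.Analysis" "HOL-Computational_Algebra.Squarefree"
begin

text \<open>\<open>squarefree 0\<close> is false, so the value at the junk argument \<open>0\<close> is \<open>0\<close>.\<close>

definition moebius_mu :: "nat \<Rightarrow> int" where
  "moebius_mu n = (if squarefree n then (-1) ^ card (prime_factors n) else 0)"

definition X' :: "nat \<Rightarrow> nat set" where
  "X' R = {n \<in> {1..R}. moebius_mu n \<noteq> 0}"

definition moebius_mu_restr :: "nat \<Rightarrow> nat \<Rightarrow> complex" where
  "moebius_mu_restr R n = (if n \<in> X' R then of_int (moebius_mu n) else 0)"

text \<open>A function on \<open>{1..R}\<close> is represented by a total function \<open>nat \<Rightarrow> complex\<close>
  of which only the values on \<open>{1..R}\<close> are used.\<close>

definition fourier_transform :: "nat \<Rightarrow> (nat \<Rightarrow> complex) \<Rightarrow> real \<Rightarrow> complex" where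
  "fourier_transform R f x =
     (\<Sum>n=1..R. f n * exp (- 2 * of_real pi * \<i> * of_nat n * of_real x))"

text \<open>The Bochner integral of a non-integrable function is \<open>0\<close>; the norms below are applied
  only to trigonometric polynomials, which are continuous and hence in every \<open>L\<^sup>p\<close> on \<open>[0,1]\<close>.\<close>

definition L1_norm_01 :: "(real \<Rightarrow> complex) \<Rightarrow> real" where
  "L1_norm_01 g = (LINT x:{0..1}|lebesgue. cmod (g x))"

definition L2_norm_01 :: "(real \<Rightarrow> complex) \<Rightarrow> real" where
  "L2_norm_01 g = sqrt (LINT x:{0..1}|lebesgue. (cmod (g x))\<^sup>2)"

definition fourier_ratio :: "nat \<Rightarrow> (nat \<Rightarrow> complex) \<Rightarrow> real" where
  "fourier_ratio R f =
     L1_norm_01 (fourier_transform R f) / L2_norm_01 (fourier_transform R f)"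

end

theory Submission
  imports Defs
begin

text \<open>By Hoelder, \<open>\<parallel>F\<parallel>\<^sub>2\<^sup>2 \<le> \<parallel>F\<parallel>\<^sub>\<infinity> \<parallel>F\<parallel>\<^sub>1\<close>, so the Fourier ratio is at least
  \<open>\<parallel>F\<parallel>\<^sub>2 / \<parallel>F\<parallel>\<^sub>\<infinity>\<close>. For \<open>F\<close> the transform of \<open>\<mu>\<close>, Parseval identifies \<open>\<parallel>F\<parallel>\<^sub>2\<^sup>2\<close> with the number of
  squarefree integers up to \<open>R\<close>, which is at least \<open>R / 4\<close>, while \<open>\<parallel>F\<parallel>\<^sub>\<infinity>\<close> is bounded by hypothesis.\<close>

text \<open>Orthogonality of characters, the input to Parseval: for \<open>k \<noteq> 0\<close> the
  antiderivative \<open>exp (c * x) / c\<close> is 1-periodic, so its endpoint values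
  cancel.\<close>

lemma integral_exp_int_frequency:
  fixes k :: int
  shows "((\<lambda>x::real. exp (2 * of_real pi * \<i> * of_int k * of_real x) :: complex)
           has_integral (if k = 0 then 1 else 0)) {0..1}"
proof (cases "k = 0")
  case True
  then show ?thesis using has_integral_const_real[of "1::complex" 0 1] by simp
next
  case False
  define c :: complex where "c = 2 * of_real pi * \<i> * of_int k"
  have c: "c \<noteq> 0" using False by (simp add: c_def)
  have "((\<lambda>x::real. exp (c * of_real x)) has_integral
          (exp (c * of_real 1) / c - exp (c * of_real 0) / c)) {0..1}"
  proof (rule fundamental_theorem_of_calculus)
    fix x :: real
    have "((\<lambda>z. exp (c * z) / c) has_field_derivative exp (c * of_real x)) (at (of_real x))"
      using c by (auto intro!: derivative_eq_intros)
    from has_vector_derivative_real_field[OF this]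
    show "((\<lambda>x::real. exp (c * of_real x) / c) has_vector_derivative exp (c * of_real x))
            (at x within {0..1})" .
  qed simp
  moreover have "exp c = 1"
    unfolding exp_eq_1 c_def by simp
  ultimately show ?thesis using False by (simp add: c_def)
qed

lemma continuous_on_fourier_transform [continuous_intros]:
  "continuous_on S (fourier_transform R f)"
  unfolding fourier_transform_def by (intro continuous_intros)

text \<open>Continuity on a compact interval gives absolute integrability, which lets the Lebesgue
  integral be exchanged for the gauge integral used below.\<close>

lemma L1_norm_01_eq_integral:
  assumes "continuous_on {0..1} g"
  shows "L1_norm_01 g = integral {0..1} (\<lambda>x. cmod (g x))"
  unfolding L1_norm_01_def using assms
  by (intro set_lebesgue_integral_eq_integral absolutely_integrable_continuous_real continuous_intros)

lemma L2_norm_01_eq_integral: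
  assumes "continuous_on {0..1} g"
  shows "L2_norm_01 g = sqrt (integral {0..1} (\<lambda>x. (cmod (g x))\<^sup>2))"
  unfolding L2_norm_01_def using assms
  by (subst set_lebesgue_integral_eq_integral)
     (intro absolutely_integrable_continuous_real continuous_intros, simp_all)

text \<open>Parseval: the squared modulus expands into a double sum over frequencies
  \<open>n - m\<close>, and integrating termwise leaves only the diagonal.\<close>

lemma L2_norm_01_fourier_transform:
  "L2_norm_01 (fourier_transform R f) = sqrt (\<Sum>n=1..R. (cmod (f n))\<^sup>2)"
proof -
  let ?F = "fourier_transform R f"
  let ?e = "\<lambda>(k::int) (x::real). exp (2 * of_real pi * \<i> * of_int k * of_real x) :: complex"
  have expand: "of_real ((cmod (?F x))\<^sup>2) =
      (\<Sum>m=1..R. \<Sum>n=1..R. f m * cnj (f n) * ?e (int n - int m) x)" for x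
  proof -
    have "of_real ((cmod (?F x))\<^sup>2) = ?F x * cnj (?F x)"
      by (rule complex_norm_square)
    also have "\<dots> = (\<Sum>m=1..R. \<Sum>n=1..R. f m * cnj (f n) *
        (exp (- 2 * of_real pi * \<i> * of_nat m * of_real x) *
         exp (2 * of_real pi * \<i> * of_nat n * of_real x)))"
      unfolding fourier_transform_def by (simp add: exp_cnj sum_product mult_ac)
    also have "\<dots> = (\<Sum>m=1..R. \<Sum>n=1..R. f m * cnj (f n) * ?e (int n - int m) x)"
      by (intro sum.cong refl) (simp add: exp_add [symmetric] algebra_simps)
    finally show ?thesis .
  qed
  have "((\<lambda>x. of_real ((cmod (?F x))\<^sup>2) :: complex) has_integral
      (\<Sum>m=1..R. \<Sum>n=1..R. f m * cnj (f n) * (if int n - int m = 0 then 1 else 0))) {0..1}"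
    unfolding expand
    by (intro has_integral_sum has_integral_mult_right integral_exp_int_frequency) auto
  also have "(\<Sum>m=1..R. \<Sum>n=1..R. f m * cnj (f n) * (if int n - int m = 0 then 1 else 0)) =
      (\<Sum>m=1..R. \<Sum>n=1..R. if m = n then f m * cnj (f n) else 0)"
    by (intro sum.cong) auto
  also have "\<dots> = of_real (\<Sum>n=1..R. (cmod (f n))\<^sup>2)"
    by (simp add: complex_norm_square del: of_real_power)
  \<comment> \<open>Taking real parts brings the complex-valued computation back to the
    reals.\<close>
  finally have "((\<lambda>x. (cmod (?F x))\<^sup>2) has_integral (\<Sum>n=1..R. (cmod (f n))\<^sup>2)) {0..1}"
    by (drule_tac has_integral_Re) (simp only: Re_complex_of_real)
  then show ?thesis
    by (simp add: L2_norm_01_eq_integral continuous_on_fourier_transform integral_unique)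
qed

text \<open>Integrate the pointwise bound \<open>|F|^2 \<le> M * |F|\<close>, then divide by
  \<open>M\<close> times the L2 norm.\<close>

lemma fourier_ratio_ge:
  assumes bound: "\<And>x. x \<in> {0..1} \<Longrightarrow> cmod (fourier_transform R f x) \<le> M" and "M > 0"
  shows "L2_norm_01 (fourier_transform R f) / M \<le> fourier_ratio R f"
proof -
  let ?F = "fourier_transform R f"
  have cont: "continuous_on {0..1} ?F" by (rule continuous_on_fourier_transform)
  have "integral {0..1} (\<lambda>x. (cmod (?F x))\<^sup>2) \<le> integral {0..1} (\<lambda>x. M * cmod (?F x))"
    using bound by (intro integral_le integrable_continuous_real continuous_intros cont)
      (auto simp: power2_eq_square intro!: mult_right_mono)
  moreover have "(L2_norm_01 ?F)\<^sup>2 = integral {0..1} (\<lambda>x. (cmod (?F x))\<^sup>2)"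
    unfolding L2_norm_01_eq_integral[OF cont]
    by (intro real_sqrt_pow2 Henstock_Kurzweil_Integration.integral_nonneg
        integrable_continuous_real continuous_intros cont) auto
  ultimately have le: "(L2_norm_01 ?F)\<^sup>2 \<le> M * L1_norm_01 ?F"
    by (simp add: L1_norm_01_eq_integral[OF cont])
  have "L2_norm_01 ?F \<ge> 0" by (simp add: L2_norm_01_fourier_transform sum_nonneg)
  then show ?thesis
    unfolding fourier_ratio_def using le \<open>M > 0\<close>
    \<comment> \<open>If the L2 norm vanishes, both sides are \<open>0\<close>, since division by
      zero yields \<open>0\<close>.\<close>
    by (cases "L2_norm_01 ?F = 0") (auto simp: field_simps power2_eq_square)
qed

lemma sum_inverse_squares_from_2_le:
  "(\<Sum>d=2..R. 1 / (real d)\<^sup>2) \<le> 3 / 4"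
proof -
  \<comment> \<open>Subtracting \<open>1 / R\<close> lets the induction telescope through
    \<open>1 / (n + 1)^2 \<le> 1 / n - 1 / (n + 1)\<close>; the constant \<open>3 / 4\<close> makes
    \<open>R = 2\<close> an equality.\<close>
  have "(\<Sum>d=2..R. 1 / (real d)\<^sup>2) \<le> 3 / 4 - 1 / R" if "R \<ge> 2"
    using that
  proof (induction R rule: dec_induct)
    case (step n)
    have "1 / (real (Suc n))\<^sup>2 \<le> 1 / (real n * real (Suc n))"
      using step unfolding power2_eq_square by (intro divide_left_mono mult_right_mono) auto
    also have "\<dots> = 1 / n - 1 / Suc n"
      using step by (simp add: divide_simps)
    finally have "1 / (real (Suc n))\<^sup>2 \<le> 1 / n - 1 / Suc n" .
    then show ?case using step by simp
  qed (simp add: power2_eq_square)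
  moreover have "3 / 4 - 1 / real R \<le> 3 / 4" by simp
  ultimately show ?thesis by (cases "R \<ge> 2") (blast intro: order_trans, simp)
qed

lemma X'_eq: "X' R = {n \<in> {1..R}. squarefree n}"
  by (auto simp: X'_def moebius_mu_def)

text \<open>Union bound: a number that is not squarefree is a multiple of some \<open>d^2\<close>
  with \<open>d \<ge> 2\<close>. At most \<open>R / d^2\<close> such multiples lie below
  \<open>R\<close>, hence at most \<open>3 * R / 4\<close> numbers are lost in total.\<close>

lemma card_X'_ge: "real R / 4 \<le> real (card (X' R))"
proof -
  \<comment> \<open>The positive multiples of \<open>d^2\<close> up to \<open>R\<close>.\<close>
  define B where "B d = (\<lambda>k. d\<^sup>2 * k) ` {1..R div d\<^sup>2}" for d :: nat
  have "{1..R} \<subseteq> X' R \<union> (\<Union>d\<in>{2..R}. B d)"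
  proof
    fix n assume n: "n \<in> {1..R}"
    show "n \<in> X' R \<union> (\<Union>d\<in>{2..R}. B d)"
    proof (cases "squarefree n")
      case False
      then obtain d where d: "d\<^sup>2 dvd n" "\<not> d dvd 1" by (auto simp: squarefree_def)
      then obtain k where k: "n = d\<^sup>2 * k" by blast
      have "d \<noteq> 0" "k \<noteq> 0" using n k by (auto intro: gr0I)
      \<comment> \<open>From \<open>d \<le> d^2 \<le> n \<le> R\<close>; this keeps the union over
        \<open>d\<close> finite.\<close>
      moreover have "d \<le> R"
        using dvd_imp_le[OF d(1)] n self_le_power[of d 2] \<open>d \<noteq> 0\<close> by simp
      moreover have "k \<le> R div d\<^sup>2"
        using n k \<open>d \<noteq> 0\<close> by (simp add: less_eq_div_iff_mult_less_eq mult.commute)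
      ultimately show ?thesis
        using d n k by (auto simp: B_def intro!: bexI[of _ d])
    qed (use n in \<open>auto simp: X'_eq\<close>)
  qed
  then have "card {1..R} \<le> card (X' R \<union> (\<Union>d\<in>{2..R}. B d))"
    by (rule card_mono[rotated]) (simp add: B_def X'_def)
  then have "R \<le> card (X' R \<union> (\<Union>d\<in>{2..R}. B d))"
    by simp
  also have "\<dots> \<le> card (X' R) + (\<Sum>d=2..R. card (B d))"
    by (rule order_trans[OF card_Un_le]) (auto intro: card_UN_le)
  finally have "R \<le> card (X' R) + (\<Sum>d=2..R. card (B d))" .
  moreover have "(\<Sum>d=2..R. card (B d)) \<le> (\<Sum>d=2..R. R div d\<^sup>2)"
    unfolding B_def by (intro sum_mono order_trans[OF card_image_le]) auto
  ultimately have "real R \<le> real (card (X' R)) + real (\<Sum>d=2..R. R div d\<^sup>2)"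
    by linarith
  moreover have "real (\<Sum>d=2..R. R div d\<^sup>2) \<le> (\<Sum>d=2..R. real R * (1 / (real d)\<^sup>2))"
    unfolding of_nat_sum by (intro sum_mono) (metis of_nat_div_le_of_nat of_nat_power times_divide_eq_right mult.right_neutral)
  moreover have "\<dots> \<le> real R * (3 / 4)"
    unfolding sum_distrib_left[symmetric]
    by (intro mult_left_mono sum_inverse_squares_from_2_le) simp
  ultimately show ?thesis by simp
qed

text \<open>The coefficients have modulus 1 on \<open>X' R\<close> and vanish elsewhere, so Parseval
  counts \<open>X' R\<close>.\<close>

lemma L2_norm_01_moebius:
  "L2_norm_01 (fourier_transform R (moebius_mu_restr R)) = sqrt (card (X' R))"
proof -
  have "(\<Sum>n=1..R. (cmod (moebius_mu_restr R n))\<^sup>2) = (\<Sum>n=1..R. if n \<in> X' R then 1 else 0)"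
    by (intro sum.cong) (auto simp: moebius_mu_restr_def moebius_mu_def X'_eq norm_power)
  also have "\<dots> = real (card ({1..R} \<inter> X' R))"
    by (simp add: sum.If_cases)
  also have "{1..R} \<inter> X' R = X' R" by (auto simp: X'_def)
  finally show ?thesis by (simp add: L2_norm_01_fourier_transform)
qed

text \<open>Reconciles the opposite signs in the exponents of the transform and of the hypothesis:
  the coefficients are real, so the two sums are complex conjugates.\<close>

lemma cmod_fourier_transform_moebius:
  "cmod (fourier_transform R (moebius_mu_restr R) x) =
   cmod (\<Sum>n=1..R. of_int (moebius_mu n) * exp (2 * of_real pi * \<i> * of_nat n * of_real x))"
proof -
  have "fourier_transform R (moebius_mu_restr R) x =
      cnj (\<Sum>n=1..R. of_int (moebius_mu n) * exp (2 * of_real pi * \<i> * of_nat n * of_real x))"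
    unfolding fourier_transform_def cnj_sum
    by (intro sum.cong) (auto simp: moebius_mu_restr_def X'_def exp_cnj)
  then show ?thesis by (simp only: complex_mod_cnj)
qed

theorem theorem1p5:
  assumes "\<forall>\<epsilon>::real. \<epsilon> > 0 \<longrightarrow> (\<exists>C::real. C > 0 \<and> (\<forall>R::nat. R \<ge> 1 \<longrightarrow>
      (SUP x\<in>{0..1::real}. cmod (\<Sum>n=1..R.
          of_int (moebius_mu n) * exp (2 * of_real pi * \<i> * of_nat n * of_real x)))
        \<le> C * real R powr (1 / 2 + \<epsilon>)))"
  shows "\<forall>\<delta>::real. \<delta> > 0 \<longrightarrow> (\<exists>R0::nat. \<forall>R\<ge>R0.
      fourier_ratio R (moebius_mu_restr R) \<ge> real R powr (- \<delta>))"
proof (intro allI impI)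
  fix \<delta> :: real assume "\<delta> > 0"
  \<comment> \<open>One half of \<open>\<delta>\<close> pays for the loss in the hypothesis, the
    other half absorbs the constant \<open>2 * C\<close>.\<close>
  define \<epsilon> where "\<epsilon> = \<delta> / 2"
  have "\<epsilon> > 0" using \<open>\<delta> > 0\<close> by (simp add: \<epsilon>_def)
  with assms obtain C where "C > 0" and C: "\<And>R::nat. R \<ge> 1 \<Longrightarrow>
      (SUP x\<in>{0..1::real}. cmod (\<Sum>n=1..R.
          of_int (moebius_mu n) * exp (2 * of_real pi * \<i> * of_nat n * of_real x)))
        \<le> C * real R powr (1 / 2 + \<epsilon>)" by blast
  show "\<exists>R0::nat. \<forall>R\<ge>R0. fourier_ratio R (moebius_mu_restr R) \<ge> real R powr (- \<delta>)"
  proof (intro exI allI impI)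
    \<comment> \<open>The threshold forces \<open>R powr \<epsilon> \<ge> 2 * C\<close>; the summand
      \<open>1\<close> ensures \<open>R \<ge> 1\<close>.\<close>
    fix R :: nat assume R: "R \<ge> nat \<lceil>(2 * C) powr (1 / \<epsilon>)\<rceil> + 1"
    let ?F = "fourier_transform R (moebius_mu_restr R)"
    let ?M = "C * real R powr (1 / 2 + \<epsilon>)"
    have "R \<ge> 1" using R by simp
    \<comment> \<open>A real \<open>SUP\<close> dominates its members only over a bounded set; here
      continuity on a compact interval supplies the bound.\<close>
    have bdd: "bdd_above ((\<lambda>x. cmod (?F x)) ` {0..1})"
      by (intro bounded_imp_bdd_above compact_imp_bounded compact_continuous_image
          continuous_intros compact_Icc)
    have "cmod (?F x) \<le> ?M" if "x \<in> {0..1}" for x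
      using cSUP_upper[OF that bdd] C[OF \<open>R \<ge> 1\<close>]
      unfolding cmod_fourier_transform_moebius by linarith
    then have ratio: "sqrt (card (X' R)) / ?M \<le> fourier_ratio R (moebius_mu_restr R)"
      using fourier_ratio_ge[of R "moebius_mu_restr R" ?M] \<open>C > 0\<close> \<open>R \<ge> 1\<close>
      by (simp add: L2_norm_01_moebius)
    have "(2 * C) powr (1 / \<epsilon>) \<le> real R" using R by linarith
    then have "((2 * C) powr (1 / \<epsilon>)) powr \<epsilon> \<le> real R powr \<epsilon>"
      using \<open>\<epsilon> > 0\<close> by (intro powr_mono2) auto
    then have large: "2 * C \<le> real R powr \<epsilon>"
      using \<open>\<epsilon> > 0\<close> \<open>C > 0\<close> by (simp add: powr_powr)
    have "real R powr (1 / 2) / 2 = sqrt (real R / 4)"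
      by (simp add: powr_half_sqrt real_sqrt_divide)
    also have "\<dots> \<le> sqrt (card (X' R))" by (intro real_sqrt_le_mono card_X'_ge)
    finally have "real R powr (1 / 2) / 2 / ?M \<le> sqrt (card (X' R)) / ?M"
      using \<open>C > 0\<close> by (intro divide_right_mono) auto
    \<comment> \<open>The right side equals \<open>R powr (- \<epsilon>) / (2 * C)\<close>, and
      \<open>- \<delta> + \<epsilon> = - \<epsilon>\<close>, so the claim reduces to
      \<open>large\<close>.\<close>
    moreover have "real R powr (- \<delta>) \<le> real R powr (1 / 2) / 2 / ?M"
    proof -
      have "real R powr (- \<delta>) * (2 * C) \<le> real R powr (- \<delta>) * real R powr \<epsilon>"
        using large by (intro mult_left_mono) auto
      also have "\<dots> = real R powr (- \<epsilon>)"
        by (simp add: powr_add[symmetric] \<epsilon>_def)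
      finally have "real R powr (- \<delta>) \<le> real R powr (- \<epsilon>) / (2 * C)"
        using \<open>C > 0\<close> by (simp add: pos_le_divide_eq)
      also have "\<dots> = real R powr (1 / 2) / 2 / ?M"
        unfolding powr_add using \<open>C > 0\<close> \<open>R \<ge> 1\<close> by (simp add: powr_minus divide_simps)
      finally show ?thesis .
    qed
    ultimately show "fourier_ratio R (moebius_mu_restr R) \<ge> real R powr (- \<delta>)"
      using ratio by linarith
  qed
qed

end
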